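(* If $G$ is the incidence graph of a $\mathrm{BIBD}(v,b,r,k,\lambda)$, then $\zeta(G) \ge \log_2(k)$.
   Context: A $\mathrm{BIBD}(v,b,r,k,\lambda)$ is a set $X$ of $v$ points together with a collection $\mathcal{B}$ of $b$ blocks (subsets of $X$) such that every block has size $k$, every point lies in exactly $r$ blocks, and every pair of distinct points lies in exactly $\lambda$ blocks. Its incidence graph is the bipartite graph on $X \cup \mathcal{B}$ with $x \sim B$ iff $x \in B$. Localization game on a connected graph $G$ with $k$ cops: the robber chooses a starting vertex, invisible to the cops. Each round the cops choose any $k$ vertices (no adjacency restriction) and each learns its distance to the robber; the cops win if after finitely many rounds they determine the robber's vertex uniquely; otherwise the robber moves to a neighbour or stays. The robber knows the cops' strategy. $\zeta(G)$ is the least $k$ for which $k$ cops can guarantee capture.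
   Formalization: A BIBD is here required to be incomplete with positive parameters (0 < k < v and λ > 0); without k < v the claim fails, e.g. for k = v ≥ 3 and b = r = λ = 1, where G is the star K_{1,v} and ζ(G) = 1; λ > 0 ensures that G is connected. *)

theory Defs
  imports Complex_Main "Graph_Theory.Graph_Theory"
begin

text \<open>
  Blocks are an indexed family, so that a block may be repeated; a design given by a set of
  blocks is the case where \<open>B\<close> is injective on \<open>I\<close>. \<open>k < v\<close> is the ``incomplete'' in ``balanced
  incomplete block design'', and the parameters are positive (\<open>0 < v\<close>, \<open>0 < b\<close> and \<open>0 < r\<close> follow
  from the conditions below).
\<close>

locale bibd =
  fixes X :: "'p set" and I :: "'i set" and B :: "'i \<Rightarrow> 'p set"
    and v b r k lam :: nat
  assumes finite_points: "finite X" and card_points: "card X = v"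
    and finite_blocks: "finite I" and card_blocks: "card I = b"
    and block_subset: "\<And>i. i \<in> I \<Longrightarrow> B i \<subseteq> X"
    and block_size: "\<And>i. i \<in> I \<Longrightarrow> card (B i) = k"
    and point_degree: "\<And>x. x \<in> X \<Longrightarrow> card {i \<in> I. x \<in> B i} = r"
    and pair_balance:
      "\<And>x y. x \<in> X \<Longrightarrow> y \<in> X \<Longrightarrow> x \<noteq> y \<Longrightarrow> card {i \<in> I. x \<in> B i \<and> y \<in> B i} = lam"
    and block_size_pos: "0 < k" and incomplete: "k < v" and lam_pos: "0 < lam"

definition incidence_graph ::
  "'p set \<Rightarrow> 'i set \<Rightarrow> ('i \<Rightarrow> 'p set) \<Rightarrow> ('p + 'i) pair_pre_digraph" where
  "incidence_graph X I B =
    \<lparr> pverts = X <+> I,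
      parcs = {(Inl x, Inr i) | x i. x \<in> X \<and> i \<in> I \<and> x \<in> B i}
            \<union> {(Inr i, Inl x) | x i. x \<in> X \<and> i \<in> I \<and> x \<in> B i} \<rparr>"

definition graph_dist :: "('a, 'b) pre_digraph \<Rightarrow> 'a \<Rightarrow> 'a \<Rightarrow> ereal" where
  "graph_dist G u w = wf_digraph.\<mu> G (\<lambda>_. 1) u w"

text \<open>\<open>p t\<close> is the vertex of the robber when the cops probe in round \<open>t\<close>, counted from \<open>0\<close>.\<close>

definition robber_walk :: "('a, 'b) pre_digraph \<Rightarrow> (nat \<Rightarrow> 'a) \<Rightarrow> bool" where
  "robber_walk G p \<longleftrightarrow>
    (\<forall>t. p t \<in> verts G) \<and> (\<forall>t. p (Suc t) = p t \<or> p t \<rightarrow>\<^bsub>G\<^esub> p (Suc t))"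

text \<open>
  A strategy for \<open>m\<close> cops maps the list of all earlier answers (one list of distances per round) to
  the next \<open>m\<close> probes. Since it is deterministic, the answers determine the earlier probes.
\<close>

definition cop_strategy ::
  "('a, 'b) pre_digraph \<Rightarrow> nat \<Rightarrow> (ereal list list \<Rightarrow> 'a list) \<Rightarrow> bool" where
  "cop_strategy G m \<sigma> \<longleftrightarrow> (\<forall>h. length (\<sigma> h) = m \<and> set (\<sigma> h) \<subseteq> verts G)"

primrec answers ::
  "('a, 'b) pre_digraph \<Rightarrow> (ereal list list \<Rightarrow> 'a list) \<Rightarrow> (nat \<Rightarrow> 'a) \<Rightarrow> nat \<Rightarrow> ereal list list" where
  "answers G \<sigma> p 0 = []"
| "answers G \<sigma> p (Suc t) =
    answers G \<sigma> p t @ [map (\<lambda>c. graph_dist G c (p t)) (\<sigma> (answers G \<sigma> p t))]"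

text \<open>
  The robber is located in round \<open>t\<close> if every robber walk that gives the same answers up to and
  including round \<open>t\<close> is at the same vertex in that round.
\<close>

definition located ::
  "('a, 'b) pre_digraph \<Rightarrow> (ereal list list \<Rightarrow> 'a list) \<Rightarrow> (nat \<Rightarrow> 'a) \<Rightarrow> nat \<Rightarrow> bool" where
  "located G \<sigma> p t \<longleftrightarrow>
    (\<forall>q. robber_walk G q \<and> answers G \<sigma> q (Suc t) = answers G \<sigma> p (Suc t) \<longrightarrow> q t = p t)"

definition cops_win :: "('a, 'b) pre_digraph \<Rightarrow> nat \<Rightarrow> bool" where
  "cops_win G m \<longleftrightarrow>
    (\<exists>\<sigma>. cop_strategy G m \<sigma> \<and> (\<forall>p. robber_walk G p \<longrightarrow> (\<exists>t. located G \<sigma> p t)))"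

definition localization_number :: "('a, 'b) pre_digraph \<Rightarrow> nat" where
  "localization_number G = (LEAST m. cops_win G m)"

lemma (in wf_digraph) graph_dist_eq_0_iff:
  assumes "u \<in> verts G"
  shows "graph_dist G u w = 0 \<longleftrightarrow> u = w"
proof -
  have cost: "awalk_cost (\<lambda>_. 1) p = real (length p)" for p
    by (induction p) auto
  show ?thesis
  proof
    assume "u = w"
    have "awalk u [] u" using assms by (simp add: awalk_Nil_iff)
    from min_cost_le_walk_cost[OF this, of "\<lambda>_. 1"] have "\<mu> (\<lambda>_. 1) u u \<le> 0"
      by (simp add: zero_ereal_def)
    moreover have "0 \<le> \<mu> (\<lambda>_. 1) u u"
      unfolding \<mu>_def cost by (rule INF_greatest) simp
    ultimately show "graph_dist G u w = 0"
      using \<open>u = w\<close> by (simp add: graph_dist_def)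
  next
    assume 0: "graph_dist G u w = 0"
    show "u = w"
    proof (rule ccontr)
      assume "u \<noteq> w"
      have "1 \<le> \<mu> (\<lambda>_. 1) u w"
        unfolding \<mu>_def cost
      proof (rule INF_greatest)
        fix p assume "p \<in> {p. awalk u p w}"
        with \<open>u \<noteq> w\<close> have "p \<noteq> []" by (auto simp: awalk_Nil_iff)
        then show "1 \<le> ereal (real (length p))"
          by (cases p) (auto simp: one_ereal_def)
      qed
      with 0 show False by (simp add: graph_dist_def)
    qed
  qed
qed

text \<open>The \<^const>\<open>Least\<close> in \<^const>\<open>localization_number\<close> ranges over a nonempty set.\<close>

lemma (in fin_digraph) cops_win_card_verts: "cops_win G (card (verts G))"
proof -
  obtain vs where vs: "set vs = verts G" "distinct vs"
    using finite_distinct_list[OF finite_verts] by blast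
  define \<sigma> :: "ereal list list \<Rightarrow> 'a list" where "\<sigma> = (\<lambda>_. vs)"
  have "cop_strategy G (card (verts G)) \<sigma>"
    using vs distinct_card[of vs] by (auto simp: cop_strategy_def \<sigma>_def)
  moreover have "located G \<sigma> p 0" if p: "robber_walk G p" for p
    unfolding located_def
  proof (intro allI impI)
    fix q assume q: "robber_walk G q \<and> answers G \<sigma> q (Suc 0) = answers G \<sigma> p (Suc 0)"
    have mem: "p 0 \<in> verts G" using p by (simp add: robber_walk_def)
    then have "graph_dist G (p 0) (q 0) = graph_dist G (p 0) (p 0)"
      using q vs by (auto simp: \<sigma>_def)
    then show "q 0 = p 0" using mem by (metis graph_dist_eq_0_iff)
  qed
  ultimately show ?thesis unfolding cops_win_def by blast
qed

context bibd
begin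

lemma incidence_graph_pair_graph: "pair_graph (incidence_graph X I B)"
proof -
  let ?G = "incidence_graph X I B"
  have "parcs ?G \<subseteq> (X <+> I) \<times> (X <+> I)" by (auto simp: incidence_graph_def)
  then have "finite (parcs ?G)"
    using finite_points finite_blocks by (meson finite_Plus finite_SigmaI finite_subset)
  moreover have "symmetric ?G"
    by (auto simp: symmetric_def sym_def incidence_graph_def)
  ultimately show ?thesis
    using finite_points finite_blocks
    by unfold_locales (auto simp: incidence_graph_def)
qed

lemma incidence_graph_strongly_connected: "strongly_connected (incidence_graph X I B)"
proof -
  let ?G = "with_proj (incidence_graph X I B)"
  interpret pair_graph "incidence_graph X I B" by (rule incidence_graph_pair_graph)
  have adj: "Inl x \<rightarrow>\<^sup>*\<^bsub>?G\<^esub> Inr i" "Inr i \<rightarrow>\<^sup>*\<^bsub>?G\<^esub> Inl x" if "x \<in> X" "i \<in> I" "x \<in> B i" for x i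
  proof -
    have "(Inl x, Inr i) \<in> parcs (incidence_graph X I B)"
      "(Inr i, Inl x) \<in> parcs (incidence_graph X I B)"
      using that by (auto simp: incidence_graph_def)
    then show "Inl x \<rightarrow>\<^sup>*\<^bsub>?G\<^esub> Inr i" "Inr i \<rightarrow>\<^sup>*\<^bsub>?G\<^esub> Inl x"
      by (auto intro: reachable_adjI)
  qed
  have pts: "Inl x \<rightarrow>\<^sup>*\<^bsub>?G\<^esub> Inl y" if xy: "x \<in> X" "y \<in> X" for x y
  proof (cases "x = y")
    case True
    have "Inl y \<in> pverts (incidence_graph X I B)" using xy by (auto simp: incidence_graph_def)
    then show ?thesis using True by (simp add: reachable_refl)
  next
    case False
    with xy pair_balance lam_pos have "{i \<in> I. x \<in> B i \<and> y \<in> B i} \<noteq> {}" by fastforce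
    then obtain i where "i \<in> I" "x \<in> B i" "y \<in> B i" by blast
    with xy adj show ?thesis by (meson reachable_trans)
  qed
  have blk: "\<exists>x \<in> X. x \<in> B i" if "i \<in> I" for i
  proof -
    have "B i \<noteq> {}" using block_size[OF that] block_size_pos by auto
    then show ?thesis using block_subset[OF that] by blast
  qed
  have to_pt: "\<exists>x \<in> X. u \<rightarrow>\<^sup>*\<^bsub>?G\<^esub> Inl x \<and> Inl x \<rightarrow>\<^sup>*\<^bsub>?G\<^esub> u" if u: "u \<in> verts ?G" for u
  proof (cases u)
    case (Inl x)
    then have "x \<in> X" using u by (auto simp: incidence_graph_def)
    then show ?thesis using pts Inl by blast
  next
    case (Inr i)
    then have i: "i \<in> I" using u by (auto simp: incidence_graph_def)
    then obtain x where "x \<in> X" "x \<in> B i" using blk by blast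
    then show ?thesis using adj i Inr by blast
  qed
  have "X \<noteq> {}" using card_points incomplete by auto
  then have "verts ?G \<noteq> {}" by (auto simp: incidence_graph_def)
  moreover have "u \<rightarrow>\<^sup>*\<^bsub>?G\<^esub> w" if "u \<in> verts ?G" "w \<in> verts ?G" for u w
    using to_pt[OF that(1)] to_pt[OF that(2)] pts by (meson reachable_trans)
  ultimately show ?thesis by (auto simp: strongly_connected_def)
qed

end

end

theory Submission
  imports Defs "HOL-Analysis.Convex"
begin

text \<open>
  In a connected bipartite graph the distances from a fixed vertex \<open>c\<close> to the neighbours of \<open>u\<close>
  are \<open>d(c,u) - 1\<close> or \<open>d(c,u) + 1\<close>. Hence \<open>m\<close> probes split the neighbours of \<open>u\<close> into at most
  \<open>2 ^ m\<close> classes, and if all degrees exceed \<open>2 ^ m\<close>, a robber who moves in every round always has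
  two indistinguishable destinations, so that even the knowledge of his previous position does not
  locate him. In the incidence graph the degrees are \<open>k\<close> and \<open>r\<close>, and \<open>k \<le> r\<close> is Fisher's
  inequality.
\<close>

section \<open>Distances in bipartite graphs\<close>

context wf_digraph
begin

lemma awalk_cost_one: "awalk_cost (\<lambda>_. 1) p = real (length p)"
  by (induction p) auto

lemma graph_dist_le_length:
  assumes "awalk u p w"
  shows "graph_dist G u w \<le> ereal (real (length p))"
  using min_cost_le_walk_cost[OF assms, of "\<lambda>_. 1"] by (simp add: graph_dist_def awalk_cost_one)

text \<open>The distance is an infimum over walks, but walk lengths are natural numbers, so a
  shortest walk exists as soon as there is any walk. This turns distances into lengths, for which
  parity makes sense.\<close>

lemma graph_dist_attained:
  assumes "u \<rightarrow>\<^sup>* w"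
  obtains p where "awalk u p w" "graph_dist G u w = ereal (real (length p))"
proof -
  obtain q where q: "awalk u q w" using assms by (auto simp: reachable_awalk)
  define p where "p = arg_min length (\<lambda>p. awalk u p w)"
  have p: "awalk u p w" "\<And>q. awalk u q w \<Longrightarrow> length p \<le> length q"
    using arg_min_nat_lemma[of "\<lambda>p. awalk u p w" q length] q by (auto simp: p_def)
  have "ereal (real (length p)) \<le> graph_dist G u w"
    unfolding graph_dist_def \<mu>_def awalk_cost_one
    by (rule INF_greatest) (use p(2) in auto)
  with graph_dist_le_length[OF p(1)] p(1) that show thesis by auto
qed

lemma awalk_snoc_arc:
  assumes "awalk u p x" and "x \<rightarrow> y"
  obtains q where "awalk u q y" "length q = Suc (length p)"
proof -
  obtain e where "e \<in> arcs G" "tail G e = x" "head G e = y"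
    using assms(2) by (auto simp: arcs_ends_def arc_to_ends_def)
  then have "awalk x [e] y" by (auto simp: awalk_simps)
  with assms(1) have "awalk u (p @ [e]) y" by (rule awalk_appendI)
  then show thesis by (rule that) simp
qed

lemma awalk_parity:
  assumes bip: "\<And>x y. x \<rightarrow> y \<Longrightarrow> (x \<in> S) \<noteq> (y \<in> S)" and "awalk u p w"
  shows "even (length p) \<longleftrightarrow> (u \<in> S \<longleftrightarrow> w \<in> S)"
  using assms(2)
proof (induction p arbitrary: u)
  case Nil
  then show ?case by (simp add: awalk_Nil_iff)
next
  case (Cons e p)
  then have e: "e \<in> arcs G" "tail G e = u" and p: "awalk (head G e) p w"
    by (auto simp: awalk_Cons_iff)
  have "u \<rightarrow> head G e" using e by (auto intro: in_arcs_imp_in_arcs_ends)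
  from bip[OF this] Cons.IH[OF p] show ?case by auto
qed

end

text \<open>Extending a shortest walk along the arc, in either direction by symmetry, shows that the
  distances to \<open>u\<close> and to a neighbour differ by at most 1; parity excludes
  equality.\<close>

lemma (in sym_digraph) card_graph_dist_neighbours_le_2:
  assumes bip: "\<And>x y. x \<rightarrow> y \<Longrightarrow> (x \<in> S) \<noteq> (y \<in> S)"
    and conn: "strongly_connected G" and "c \<in> verts G" "u \<in> verts G"
  shows "card (graph_dist G c ` {w. u \<rightarrow> w}) \<le> 2"
proof -
  have reach: "c \<rightarrow>\<^sup>* x" if "x \<in> verts G" for x
    using conn assms(3) that by (auto simp: strongly_connected_def)
  obtain p where p: "awalk c p u" "graph_dist G c u = ereal (real (length p))"
    using graph_dist_attained[OF reach[OF assms(4)]] .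
  \<comment> \<open>Truncated subtraction does no harm: if \<open>length p = 0\<close>, then the
    neighbour is at distance 1 and the second value applies.\<close>
  have "graph_dist G c w \<in> {ereal (real (length p - 1)), ereal (real (length p + 1))}"
    if w: "u \<rightarrow> w" for w
  proof -
    have wu: "w \<rightarrow> u" using sym_arcs w by (auto simp: symmetric_def elim: symE)
    obtain q where q: "awalk c q w" "graph_dist G c w = ereal (real (length q))"
      using graph_dist_attained[OF reach] adj_in_verts(2)[OF w] by blast
    obtain p' where "awalk c p' w" "length p' = Suc (length p)"
      using awalk_snoc_arc[OF p(1) w] .
    then have "length q \<le> Suc (length p)" using graph_dist_le_length[of c p' w] q(2) by simp
    moreover obtain q' where "awalk c q' u" "length q' = Suc (length q)"
      using awalk_snoc_arc[OF q(1) wu] .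
    then have "length p \<le> Suc (length q)" using graph_dist_le_length[of c q' u] p(2) by simp
    moreover have "even (length q) \<noteq> even (length p)"
      using awalk_parity[OF bip p(1)] awalk_parity[OF bip q(1)] bip[OF w] by blast
    then have "length q \<noteq> length p" by auto
    ultimately have "length q = length p - 1 \<or> length q = length p + 1" by linarith
    with q(2) show ?thesis by auto
  qed
  then have "graph_dist G c ` {w. u \<rightarrow> w}
      \<subseteq> {ereal (real (length p - 1)), ereal (real (length p + 1))}" by blast
  then have "card (graph_dist G c ` {w. u \<rightarrow> w})
      \<le> card {ereal (real (length p - 1)), ereal (real (length p + 1))}"
    by (intro card_mono) auto
  also have "\<dots> \<le> 2" by (simp add: card_insert_if)
  finally show ?thesis .
qed

section \<open>Evading the cops\<close>

text \<open>By induction on the probes, since an answer vector is determined by its head and its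
  tail. With \<open>a = 2\<close> this counts the answers available on a neighbourhood.\<close>

lemma card_map_image_le:
  assumes "finite N" and "\<And>c. c \<in> set cs \<Longrightarrow> card (f c ` N) \<le> a"
  shows "card ((\<lambda>w. map (\<lambda>c. f c w) cs) ` N) \<le> a ^ length cs"
  using assms(2)
proof (induction cs)
  case Nil
  have "(\<lambda>w. map (\<lambda>c. f c w) []) ` N \<subseteq> {[]}" by auto
  from card_mono[OF _ this] show ?case by simp
next
  case (Cons c cs)
  let ?R = "(\<lambda>w. map (\<lambda>c. f c w) cs) ` N"
  have "(\<lambda>w. map (\<lambda>c. f c w) (c # cs)) ` N \<subseteq> (\<lambda>(x, xs). x # xs) ` (f c ` N \<times> ?R)" by auto
  then have "card ((\<lambda>w. map (\<lambda>c. f c w) (c # cs)) ` N) \<le> card (f c ` N \<times> ?R)"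
    using assms(1) by (intro surj_card_le) auto
  also have "\<dots> = card (f c ` N) * card ?R" by (rule card_cartesian_product)
  also have "\<dots> \<le> a * a ^ length cs" using Cons by (intro mult_mono) auto
  finally show ?case by simp
qed

lemma answers_cong:
  assumes "\<And>s. s < t \<Longrightarrow> p s = q s"
  shows "answers G \<sigma> p t = answers G \<sigma> q t"
  using assms by (induction t) auto

text \<open>The strategy is a fixed function of the answers, so a walk can be built against it
  recursively: always move to \<open>w\<close>, keeping \<open>w'\<close> as a decoy with the same
  answers. No round locates this walk, because a deviation to the decoy in that very round goes
  unnoticed.\<close>

lemma (in wf_digraph) not_cops_winI:
  assumes "u0 \<in> verts G"
    and ambiguous: "\<And>u cs. u \<in> verts G \<Longrightarrow> length cs = m \<Longrightarrow> set cs \<subseteq> verts G \<Longrightarrow>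
      \<exists>w w'. u \<rightarrow> w \<and> u \<rightarrow> w' \<and> w \<noteq> w' \<and> (\<forall>c \<in> set cs. graph_dist G c w = graph_dist G c w')"
  shows "\<not> cops_win G m"
proof
  assume "cops_win G m"
  then obtain \<sigma> where \<sigma>: "cop_strategy G m \<sigma>"
    and win: "\<And>p. robber_walk G p \<Longrightarrow> \<exists>t. located G \<sigma> p t"
    unfolding cops_win_def by blast
  define amb where "amb h u w w' \<longleftrightarrow> u \<rightarrow> w \<and> u \<rightarrow> w' \<and> w \<noteq> w' \<and>
    (\<forall>c \<in> set (\<sigma> h). graph_dist G c w = graph_dist G c w')" for h u w w'
  have "\<forall>h u. \<exists>w w'. u \<in> verts G \<longrightarrow> amb h u w w'"
    using ambiguous \<sigma> unfolding cop_strategy_def amb_def by meson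
  then obtain w w' where "\<forall>h u. u \<in> verts G \<longrightarrow> amb h u (w h u) (w' h u)" by metis
  then have ww': "u \<rightarrow> w h u" "u \<rightarrow> w' h u" "w h u \<noteq> w' h u"
    "\<forall>c \<in> set (\<sigma> h). graph_dist G c (w h u) = graph_dist G c (w' h u)" if "u \<in> verts G" for h u
    using that by (auto simp: amb_def)
  \<comment> \<open>The state is the list of answers so far, with the vertex from which the robber moves next.\<close>
  define st where "st = rec_nat ([], u0)
    (\<lambda>_ (h, u). (h @ [map (\<lambda>c. graph_dist G c (w h u)) (\<sigma> h)], w h u))"
  define h where "h t = fst (st t)" for t
  define p where "p t = snd (st t)" for t
  have p0: "p 0 = u0" and h0: "h 0 = []" by (simp_all add: p_def h_def st_def)
  have pS: "p (Suc t) = w (h t) (p t)"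
    and hS: "h (Suc t) = h t @ [map (\<lambda>c. graph_dist G c (p (Suc t))) (\<sigma> (h t))]" for t
    by (simp_all add: p_def h_def st_def case_prod_beta)
  have pV: "p t \<in> verts G" for t
  proof (induction t)
    case 0
    then show ?case using assms(1) p0 by simp
  next
    case (Suc t)
    then show ?case using adj_in_verts(2)[OF ww'(1)[of "p t" "h t"]] pS by simp
  qed
  \<comment> \<open>The shift by one makes \<open>u0\<close> a fictitious position before round 0,
    so that the first probe already faces two candidates.\<close>
  define P where "P t = p (Suc t)" for t
  have ans: "answers G \<sigma> P t = h t" for t
    by (induction t) (simp_all add: h0 hS P_def)
  have "p t \<rightarrow> p (Suc t)" for t unfolding pS using ww'(1) pV by blast
  then have walk: "robber_walk G P"
    using pV unfolding robber_walk_def P_def by blast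
  then obtain t where loc: "located G \<sigma> P t" using win by blast
  \<comment> \<open>The rival walk leaves \<open>P\<close> in round \<open>t\<close> for the decoy
    and then stays there forever, which the rules allow.\<close>
  define Q where "Q s = (if s < t then P s else w' (h t) (p t))" for s
  have step: "p t \<rightarrow> w' (h t) (p t)" using ww' pV by blast
  have "robber_walk G Q"
    unfolding robber_walk_def
  proof (intro conjI allI)
    fix s
    show "Q s \<in> verts G" using pV adj_in_verts(2)[OF step] by (simp add: Q_def P_def)
    consider "Suc s < t" | "Suc s = t" | "t \<le> s" by linarith
    then show "Q (Suc s) = Q s \<or> Q s \<rightarrow> Q (Suc s)"
    proof cases
      case 1
      then show ?thesis using walk by (auto simp: robber_walk_def Q_def)
    next
      case 2
      then show ?thesis using step by (auto simp: Q_def P_def)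
    next
      case 3
      then show ?thesis by (simp add: Q_def)
    qed
  qed
  moreover have "answers G \<sigma> Q t = h t"
    using answers_cong[of t Q P G \<sigma>] ans by (simp add: Q_def)
  then have "answers G \<sigma> Q (Suc t) = answers G \<sigma> P (Suc t)"
    using ww'(4)[OF pV[of t], of "h t"] by (simp add: ans Q_def P_def pS)
  ultimately have "Q t = P t" using loc by (auto simp: located_def)
  then show False using ww'(3)[OF pV[of t], of "h t"] by (simp add: Q_def P_def pS)
qed

theorem (in pseudo_graph) not_cops_win_bipartite:
  assumes bip: "\<And>x y. x \<rightarrow> y \<Longrightarrow> (x \<in> S) \<noteq> (y \<in> S)"
    and conn: "strongly_connected G"
    and deg: "\<And>u. u \<in> verts G \<Longrightarrow> 2 ^ m < card {w. u \<rightarrow> w}"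
  shows "\<not> cops_win G m"
proof -
  obtain u0 where "u0 \<in> verts G" using conn by (auto simp: strongly_connected_def)
  then show ?thesis
  proof (rule not_cops_winI)
    fix u cs assume u: "u \<in> verts G" and cs: "length cs = m" "set cs \<subseteq> verts G"
    let ?N = "{w. u \<rightarrow> w}" and ?f = "\<lambda>w. map (\<lambda>c. graph_dist G c w) cs"
    \<comment> \<open>An infinite set has \<open>card\<close> 0, so the degree bound already forces
      finiteness.\<close>
    have "finite ?N" using deg[OF u] by (intro card_ge_0_finite) simp
    then have "card (?f ` ?N) \<le> 2 ^ length cs"
      using card_graph_dist_neighbours_le_2[OF bip conn _ u] cs(2)
      by (intro card_map_image_le) auto
    then have "\<not> inj_on ?f ?N" using deg[OF u] cs(1) by (intro pigeonhole) simp
    then obtain w w' where "u \<rightarrow> w" "u \<rightarrow> w'" "w \<noteq> w'" "?f w = ?f w'"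
      by (auto simp: inj_on_def)
    then show "\<exists>w w'. u \<rightarrow> w \<and> u \<rightarrow> w' \<and> w \<noteq> w' \<and>
        (\<forall>c \<in> set cs. graph_dist G c w = graph_dist G c w')" by auto
  qed
qed

section \<open>Fisher's inequality\<close>

lemma sum_card_swap:
  fixes R :: "'a \<Rightarrow> 'c \<Rightarrow> bool"
  assumes "finite S" "finite T"
  shows "(\<Sum>s\<in>S. card {t \<in> T. R s t}) = (\<Sum>t\<in>T. card {s \<in> S. R s t})"
  using assms by (intro sum_multicount_gen) auto

context bibd
begin

lemma finite_block: "i \<in> I \<Longrightarrow> finite (B i)"
  using block_subset finite_points finite_subset by blast

lemma points_times_degree: "v * r = b * k"
proof -
  have "v * r = (\<Sum>x\<in>X. card {i \<in> I. x \<in> B i})" using card_points point_degree by simp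
  also have "\<dots> = (\<Sum>i\<in>I. card {x \<in> X. x \<in> B i})"
    by (rule sum_card_swap[OF finite_points finite_blocks])
  also have "\<dots> = (\<Sum>i\<in>I. k)"
  proof (rule sum.cong)
    fix i assume i: "i \<in> I"
    have "{x \<in> X. x \<in> B i} = B i" using block_subset[OF i] by auto
    then show "card {x \<in> X. x \<in> B i} = k" using block_size[OF i] by simp
  qed simp
  finally show ?thesis using card_blocks by simp
qed

text \<open>Fix a point \<open>x\<close> and count in two ways the pairs of another point
  \<open>y\<close> and a block containing both.\<close>

lemma degree_times_block_size: "r * (k - 1) = lam * (v - 1)"
proof -
  obtain x where x: "x \<in> X" using card_points incomplete by fastforce
  let ?I = "{i \<in> I. x \<in> B i}"
  have "lam * (v - 1) = (\<Sum>y\<in>X - {x}. lam)" using x card_points by simp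
  also have "\<dots> = (\<Sum>y\<in>X - {x}. card {i \<in> ?I. y \<in> B i})"
  proof (rule sum.cong)
    fix y assume "y \<in> X - {x}"
    then have "card {i \<in> I. x \<in> B i \<and> y \<in> B i} = lam" using pair_balance x by auto
    moreover have "{i \<in> ?I. y \<in> B i} = {i \<in> I. x \<in> B i \<and> y \<in> B i}" by auto
    ultimately show "lam = card {i \<in> ?I. y \<in> B i}" by simp
  qed simp
  also have "\<dots> = (\<Sum>i\<in>?I. card {y \<in> X - {x}. y \<in> B i})"
    using finite_points finite_blocks by (intro sum_card_swap) auto
  also have "\<dots> = (\<Sum>i\<in>?I. k - 1)"
  proof (rule sum.cong)
    fix i assume i: "i \<in> ?I"
    then have "{y \<in> X - {x}. y \<in> B i} = B i - {x}" using block_subset by auto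
    then show "card {y \<in> X - {x}. y \<in> B i} = k - 1" using i block_size by simp
  qed simp
  also have "\<dots> = r * (k - 1)" using point_degree[OF x] by simp
  finally show ?thesis by simp
qed

lemma sum_intersections:
  assumes "i \<in> I"
  shows "(\<Sum>j\<in>I. card (B i \<inter> B j)) = k * r"
proof -
  have "(\<Sum>j\<in>I. card {x \<in> B i. x \<in> B j}) = (\<Sum>x\<in>B i. card {j \<in> I. x \<in> B j})"
    by (rule sum_card_swap[symmetric]) (use finite_block assms finite_blocks in auto)
  also have "\<dots> = (\<Sum>x\<in>B i. r)"
    using block_subset[OF assms] point_degree by (intro sum.cong) auto
  finally show ?thesis using block_size[OF assms] by (simp add: Int_def)
qed

text \<open>Counts triples of a block index \<open>j\<close> and an ordered pair of points in
  \<open>B i \<inter> B j\<close>: a diagonal pair contributes \<open>r\<close>, any other pair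
  \<open>lam\<close>.\<close>

lemma sum_intersections_squared:
  assumes "i \<in> I"
  shows "(\<Sum>j\<in>I. (card (B i \<inter> B j))\<^sup>2) = k * (r + (k - 1) * lam)"
proof -
  have "(\<Sum>j\<in>I. (card (B i \<inter> B j))\<^sup>2)
      = (\<Sum>j\<in>I. card {z \<in> B i \<times> B i. fst z \<in> B j \<and> snd z \<in> B j})"
  proof (rule sum.cong)
    fix j
    have "{z \<in> B i \<times> B i. fst z \<in> B j \<and> snd z \<in> B j} = (B i \<inter> B j) \<times> (B i \<inter> B j)" by auto
    then show "(card (B i \<inter> B j))\<^sup>2 = card {z \<in> B i \<times> B i. fst z \<in> B j \<and> snd z \<in> B j}"
      by (simp add: card_cartesian_product power2_eq_square)
  qed simp
  also have "\<dots> = (\<Sum>z\<in>B i \<times> B i. card {j \<in> I. fst z \<in> B j \<and> snd z \<in> B j})"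
    by (rule sum_card_swap[symmetric]) (use finite_block assms finite_blocks in auto)
  also have "\<dots> = (\<Sum>x\<in>B i. \<Sum>y\<in>B i. card {j \<in> I. x \<in> B j \<and> y \<in> B j})"
    by (simp add: sum.cartesian_product case_prod_beta)
  also have "\<dots> = (\<Sum>x\<in>B i. r + (k - 1) * lam)"
  proof (rule sum.cong)
    fix x assume x: "x \<in> B i"
    have "(\<Sum>y\<in>B i. card {j \<in> I. x \<in> B j \<and> y \<in> B j})
        = r + (\<Sum>y\<in>B i - {x}. card {j \<in> I. x \<in> B j \<and> y \<in> B j})"
      using x block_subset[OF assms] point_degree finite_block[OF assms]
      by (subst sum.remove[of _ x]) auto
    also have "(\<Sum>y\<in>B i - {x}. card {j \<in> I. x \<in> B j \<and> y \<in> B j}) = (\<Sum>y\<in>B i - {x}. lam)"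
      using x block_subset[OF assms] pair_balance by (intro sum.cong) auto
    also have "\<dots> = (k - 1) * lam" using x block_size[OF assms] by simp
    finally show "(\<Sum>y\<in>B i. card {j \<in> I. x \<in> B j \<and> y \<in> B j}) = r + (k - 1) * lam" .
  qed simp
  finally show ?thesis using block_size[OF assms] by simp
qed

text \<open>
  The Cauchy-Schwarz inequality for the intersection sizes of a fixed block with all others,
  cleared of \<open>b\<close> and \<open>lam\<close>, reads \<open>r (v - k)\<^sup>2 (r - k) \<ge> 0\<close>.
\<close>

theorem block_size_le_degree: "k \<le> r"
proof -
  obtain x where x: "x \<in> X" using card_points incomplete by fastforce
  have "X \<noteq> {x}" using card_points incomplete block_size_pos by auto
  then obtain y where "y \<in> X" "y \<noteq> x" using x by blast
  then have "{i \<in> I. x \<in> B i \<and> y \<in> B i} \<noteq> {}" using pair_balance[OF x] lam_pos by fastforce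
  \<comment> \<open>This is the fixed block; its existence also yields \<open>0 < r\<close>, which
    is needed to cancel \<open>r\<close> at the end.\<close>
  then obtain i where i: "i \<in> I" "x \<in> B i" by blast
  then have "{i \<in> I. x \<in> B i} \<noteq> {}" by blast
  then have r: "0 < r" using finite_blocks unfolding point_degree[OF x, symmetric]
    by (simp add: card_gt_0_iff)
  have b: "0 < b" using i card_blocks finite_blocks by (auto simp: card_gt_0_iff)
  let ?a = "\<lambda>j. real (card (B i \<inter> B j))"
  have ii: "?a i = real k" using block_size[OF i(1)] by simp
  have "(\<Sum>j\<in>I. ?a j) = real k * real r"
    using sum_intersections[OF i(1)] by (simp flip: of_nat_sum)
  \<comment> \<open>The term \<open>j = i\<close> is removed, so Cauchy-Schwarz runs over the
    remaining \<open>b - 1\<close> indices.\<close>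
  then have S1: "(\<Sum>j\<in>I - {i}. ?a j) = real k * real r - real k"
    using sum.remove[OF finite_blocks i(1), of ?a] ii by simp
  have "(\<Sum>j\<in>I. (?a j)\<^sup>2) = real k * (real r + (real k - 1) * real lam)"
    using sum_intersections_squared[OF i(1)] block_size_pos
    by (simp add: of_nat_diff flip: of_nat_sum of_nat_power)
  then have S2: "(\<Sum>j\<in>I - {i}. (?a j)\<^sup>2)
      = real k * (real r + (real k - 1) * real lam) - (real k)\<^sup>2"
    using sum.remove[OF finite_blocks i(1), of "\<lambda>j. (?a j)\<^sup>2"] ii by simp
  have N: "real (card (I - {i})) = real b - 1"
    using i(1) finite_blocks card_blocks b by (simp add: of_nat_diff)
  define V R K L N where "V = real v" and "R = real r" and "K = real k" and "L = real lam"
    and "N = real b"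
  have "(K * R - K)\<^sup>2 \<le> (N - 1) * (K * (R + (K - 1) * L) - K\<^sup>2)"
    using sum_squared_le_sum_of_squares[of ?a "I - {i}"] S1 S2 N
    by (simp add: V_def R_def K_def L_def N_def mult.commute)
  moreover have pos: "0 < K" "K < V" "0 < R" using block_size_pos incomplete r
    by (simp_all add: V_def R_def K_def)
  moreover have NK: "N * K = V * R"
    using points_times_degree by (simp add: V_def R_def K_def N_def flip: of_nat_mult)
  have LV: "L * (V - 1) = R * (K - 1)"
  proof -
    have "real (r * (k - 1)) = real (lam * (v - 1))" using degree_times_block_size by simp
    then show ?thesis using block_size_pos incomplete
      by (simp add: V_def R_def K_def L_def of_nat_diff)
  qed
  have "V > 1" using block_size_pos incomplete by (simp add: V_def)
  \<comment> \<open>After multiplication by \<open>V - 1\<close>, the right side can be grouped so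
    that \<open>N\<close> and \<open>L\<close> occur only in \<open>N * K\<close> and
    \<open>L * (V - 1)\<close>, and the two counting identities eliminate them.\<close>
  ultimately have "(V - 1) * (K * R - K)\<^sup>2
      \<le> (V - 1) * ((N - 1) * (K * (R + (K - 1) * L) - K\<^sup>2))"
    by (intro mult_left_mono) auto
  also have "\<dots> = (N * K - K) * ((V - 1) * R + (K - 1) * (L * (V - 1)) - K * (V - 1))"
    by algebra
  also have "\<dots> = (V * R - K) * ((V - 1) * R + (K - 1) * (R * (K - 1)) - K * (V - 1))"
    unfolding NK LV ..
  finally have "0 \<le> (R * (V - K)\<^sup>2) * (R - K)"
    by (simp add: algebra_simps power2_eq_square)
  moreover have "0 < R * (V - K)\<^sup>2" using pos by simp
  ultimately have "K \<le> R" by (simp add: zero_le_mult_iff)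
  then show ?thesis by (simp add: K_def R_def)
qed

section \<open>The incidence graph\<close>

lemma cops_win_incidence_graph:
  assumes "cops_win (with_proj (incidence_graph X I B)) m"
  shows "k \<le> 2 ^ m"
proof (rule ccontr)
  let ?G = "with_proj (incidence_graph X I B)"
  interpret G: pair_graph "incidence_graph X I B" by (rule incidence_graph_pair_graph)
  assume "\<not> k \<le> 2 ^ m"
  \<comment> \<open>Block vertices have degree \<open>k\<close> and point vertices degree
    \<open>r\<close>; Fisher's inequality makes the bound on \<open>k\<close> serve for
    both.\<close>
  then have m: "2 ^ m < k" "2 ^ m < r" using block_size_le_degree by auto
  have "pseudo_graph ?G" by unfold_locales
  then have "\<not> cops_win ?G m"
  proof (rule pseudo_graph.not_cops_win_bipartite[where S = "range Inl"])
    show "(u \<in> range Inl) \<noteq> (w \<in> range Inl)" if "u \<rightarrow>\<^bsub>?G\<^esub> w" for u w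
      using that by (auto simp: incidence_graph_def)
    show "strongly_connected ?G" by (rule incidence_graph_strongly_connected)
    show "2 ^ m < card {w. u \<rightarrow>\<^bsub>?G\<^esub> w}" if u: "u \<in> verts ?G" for u
    proof (cases u)
      case (Inl x)
      then have x: "x \<in> X" using u by (auto simp: incidence_graph_def)
      have "{w. u \<rightarrow>\<^bsub>?G\<^esub> w} = Inr ` {i \<in> I. x \<in> B i}"
        using x Inl by (auto simp: incidence_graph_def)
      then show ?thesis using m(2) point_degree[OF x] by (simp add: card_image)
    next
      case (Inr i)
      then have i: "i \<in> I" using u by (auto simp: incidence_graph_def)
      have "{w. u \<rightarrow>\<^bsub>?G\<^esub> w} = Inl ` B i"
        using i Inr block_subset[OF i] by (auto simp: incidence_graph_def)
      then show ?thesis using m(1) block_size[OF i] by (simp add: card_image)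
    qed
  qed
  with assms show False by blast
qed

end

theorem theorem2p4:
  fixes X :: "'p set" and I :: "'i set" and B :: "'i \<Rightarrow> 'p set"
    and v b r k lam :: nat
  assumes "bibd X I B v b r k lam"
  shows "real (localization_number (with_proj (incidence_graph X I B))) \<ge> log 2 (real k)"
proof -
  interpret bibd X I B v b r k lam by fact
  interpret G: pair_graph "incidence_graph X I B" by (rule incidence_graph_pair_graph)
  let ?m = "localization_number (with_proj (incidence_graph X I B))"
  \<comment> \<open>The minimum is attained because one cop on each vertex wins.\<close>
  have "cops_win (with_proj (incidence_graph X I B)) ?m"
    unfolding localization_number_def by (rule LeastI, rule G.cops_win_card_verts)
  then have "k \<le> 2 ^ ?m" by (rule cops_win_incidence_graph)
  then have "real k \<le> 2 ^ ?m" by (metis of_nat_le_iff of_nat_numeral of_nat_power)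
  then show ?thesis using block_size_pos by (simp add: log_le_iff powr_realpow)
qed

end
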